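(* Let $M>1$ be a constant and let $\beta=\beta_n\in\mathbb R$, $\sigma=\sigma_n>0$ satisfy $$\limsup_{n\to\infty}\frac{n\beta^2}{4\sigma^2\log n}<1 .$$ Then for all sufficiently large $n$ there exists a model (an array $(\mu_{kl})_{k,l\in[n]}$ and a noise distribution for $(Z_{ij})_{1\le i\ne j\le n}$) satisfying the noise condition (N), the signal condition (S) and the upper signal condition (U), such that $$\liminf_{n\to\infty}\ \inf_{\hat r}\sup_{r\in\mathcal R}\mathbb P_r(\hat r\ne r)\ge\frac12,$$ where the infimum is over all estimators $\hat r$, i.e. measurable functions of $\{X_{ij}\}_{1\le i\ne j\le n}$ with values in $[n]^n$.
   Context: Write $[n]=\{1,\dots,n\}$ and let $\|\cdot\|$ be the Euclidean norm on $\mathbb R^n$. Rank space: $\mathcal R=\{r=(r(1),\dots,r(n))\in[n]^n:\ |\sum_{i=1}^n r(i)-\sum_{i=1}^n i|\le c_n\}$, where $c_n$ is a given sequence with $1\le c_n=o(\sqrt n)$. Model: for a real array $(\mu_{kl})_{k,l\in[n]}$ and $r\in\mathcal R$, $\mathbb P_r$ is the law of the observations $\{X_{ij}\}_{1\le i\ne j\le n}$, $X_{ij}=\mu_{r(i)r(j)}+Z_{ij}$. (N) Noise condition: for every $t>0$ and all reals $(v_{ij})_{1\le i\neq j\le n}$ with $\sum_{i\ne j}v_{ij}^2=1$, $\mathbb P(\sum_{1\le i\ne j\le n}v_{ij}Z_{ij}>t)\le\exp(-t^2/(2\sigma^2))$. (S) Signal condition: for all $r,\tilde r\in\mathcal R$,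 $\sum_{1\le i\ne j\le n}(\mu_{\tilde r(i)\tilde r(j)}-\mu_{r(i)r(j)})^2\ge 2n\beta^2\|\tilde r-r\|^2$. (U) Upper signal condition: for all $r,\tilde r\in\mathcal R$, $\sum_{1\le i\ne j\le n}(\mu_{\tilde r(i)\tilde r(j)}-\mu_{r(i)r(j)})^2\le 2Mn\beta^2\|\tilde r-r\|^2$. *)

theory Defs
  imports "HOL-Probability.Probability" "HOL-Library.Landau_Symbols"
begin

(* Vectors in [n]^n are extensional functions on {1..n}. *)
definition ranks :: "nat \<Rightarrow> (nat \<Rightarrow> nat) set" where
  "ranks n = {1..n} \<rightarrow>\<^sub>E {1..n}"

definition rank_space :: "nat \<Rightarrow> real \<Rightarrow> (nat \<Rightarrow> nat) set" where
  "rank_space n c = {r \<in> ranks n. \<bar>(\<Sum>i=1..n. real (r i)) - (\<Sum>i=1..n. real i)\<bar> \<le> c}"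

definition rank_dist :: "nat \<Rightarrow> (nat \<Rightarrow> nat) \<Rightarrow> (nat \<Rightarrow> nat) \<Rightarrow> real" where
  "rank_dist n r' r = L2_set (\<lambda>i. real (r' i) - real (r i)) {1..n}"

definition offdiag :: "nat \<Rightarrow> (nat \<times> nat) set" where
  "offdiag n = {(i, j). i \<in> {1..n} \<and> j \<in> {1..n} \<and> i \<noteq> j}"

definition obs_space :: "nat \<Rightarrow> (nat \<times> nat \<Rightarrow> real) measure" where
  "obs_space n = PiM (offdiag n) (\<lambda>_. borel)"

(* The noise enters the problem only through the joint law of its entries, so a noise
   distribution is a probability measure on the space of off-diagonal arrays. *)
definition noise_distribution :: "nat \<Rightarrow> (nat \<times> nat \<Rightarrow> real) measure \<Rightarrow> bool" where
  "noise_distribution n \<nu> \<longleftrightarrow> prob_space \<nu> \<and> sets \<nu> = sets (obs_space n)"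

definition noise_condition :: "nat \<Rightarrow> real \<Rightarrow> (nat \<times> nat \<Rightarrow> real) measure \<Rightarrow> bool" where
  "noise_condition n \<sigma> \<nu> \<longleftrightarrow>
     (\<forall>t > 0. \<forall>v :: nat \<times> nat \<Rightarrow> real. (\<Sum>p\<in>offdiag n. (v p)\<^sup>2) = 1 \<longrightarrow>
        measure \<nu> {z \<in> space \<nu>. (\<Sum>p\<in>offdiag n. v p * z p) > t} \<le> exp (- (t\<^sup>2 / (2 * \<sigma>\<^sup>2))))"

(* The array mu is only ever evaluated at indices in {1..n}. *)
definition signal_gap ::
    "nat \<Rightarrow> (nat \<Rightarrow> nat \<Rightarrow> real) \<Rightarrow> (nat \<Rightarrow> nat) \<Rightarrow> (nat \<Rightarrow> nat) \<Rightarrow> real" where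
  "signal_gap n \<mu> r' r = (\<Sum>(i, j)\<in>offdiag n. (\<mu> (r' i) (r' j) - \<mu> (r i) (r j))\<^sup>2)"

definition signal_condition :: "nat \<Rightarrow> real \<Rightarrow> real \<Rightarrow> (nat \<Rightarrow> nat \<Rightarrow> real) \<Rightarrow> bool" where
  "signal_condition n c \<beta> \<mu> \<longleftrightarrow>
     (\<forall>r \<in> rank_space n c. \<forall>r' \<in> rank_space n c.
        signal_gap n \<mu> r' r \<ge> 2 * real n * \<beta>\<^sup>2 * (rank_dist n r' r)\<^sup>2)"

definition upper_signal_condition ::
    "nat \<Rightarrow> real \<Rightarrow> real \<Rightarrow> real \<Rightarrow> (nat \<Rightarrow> nat \<Rightarrow> real) \<Rightarrow> bool" where
  "upper_signal_condition n c M \<beta> \<mu> \<longleftrightarrow>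
     (\<forall>r \<in> rank_space n c. \<forall>r' \<in> rank_space n c.
        signal_gap n \<mu> r' r \<le> 2 * M * real n * \<beta>\<^sup>2 * (rank_dist n r' r)\<^sup>2)"

definition observation_law ::
    "nat \<Rightarrow> (nat \<Rightarrow> nat \<Rightarrow> real) \<Rightarrow> (nat \<times> nat \<Rightarrow> real) measure \<Rightarrow> (nat \<Rightarrow> nat)
      \<Rightarrow> (nat \<times> nat \<Rightarrow> real) measure" where
  "observation_law n \<mu> \<nu> r =
     distr \<nu> (obs_space n) (\<lambda>z. \<lambda>(i, j)\<in>offdiag n. \<mu> (r i) (r j) + z (i, j))"

definition estimators :: "nat \<Rightarrow> ((nat \<times> nat \<Rightarrow> real) \<Rightarrow> (nat \<Rightarrow> nat)) set" where
  "estimators n = measurable (obs_space n) (count_space (ranks n))"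

definition error_prob ::
    "nat \<Rightarrow> (nat \<Rightarrow> nat \<Rightarrow> real) \<Rightarrow> (nat \<times> nat \<Rightarrow> real) measure
      \<Rightarrow> ((nat \<times> nat \<Rightarrow> real) \<Rightarrow> (nat \<Rightarrow> nat)) \<Rightarrow> (nat \<Rightarrow> nat) \<Rightarrow> ennreal" where
  "error_prob n \<mu> \<nu> rhat r =
     emeasure (observation_law n \<mu> \<nu> r) {x \<in> space (obs_space n). rhat x \<noteq> r}"

(* The values are probabilities; they are taken in the complete lattice ennreal so that the
   infimum, the supremum and the limit inferior over n are unconditionally meaningful. *)
definition minimax_error ::
    "nat \<Rightarrow> real \<Rightarrow> (nat \<Rightarrow> nat \<Rightarrow> real) \<Rightarrow> (nat \<times> nat \<Rightarrow> real) measure \<Rightarrow> ennreal" where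
  "minimax_error n c \<mu> \<nu> =
     (INF rhat \<in> estimators n. SUP r \<in> rank_space n c. error_prob n \<mu> \<nu> rhat r)"

lemma prob_space_observation_law:
  assumes "noise_distribution n \<nu>"
  shows "prob_space (observation_law n \<mu> \<nu> r)"
proof -
  have s: "sets \<nu> = sets (obs_space n)" and p: "prob_space \<nu>"
    using assms by (auto simp: noise_distribution_def)
  have "(\<lambda>z. \<lambda>(i, j)\<in>offdiag n. \<mu> (r i) (r j) + z (i, j))
          \<in> measurable (obs_space n) (obs_space n)"
    unfolding obs_space_def
  proof (rule measurable_restrict)
    fix p assume "p \<in> offdiag n"
    then show "(\<lambda>z. case p of (i, j) \<Rightarrow> \<mu> (r i) (r j) + z (i, j))
        \<in> borel_measurable (Pi\<^sub>M (offdiag n) (\<lambda>_. borel))"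
      by (cases p) (auto intro!: borel_measurable_add measurable_component_singleton)
  qed
  then have "(\<lambda>z. \<lambda>(i, j)\<in>offdiag n. \<mu> (r i) (r j) + z (i, j)) \<in> measurable \<nu> (obs_space n)"
    using s by (simp cong: measurable_cong_sets)
  then show ?thesis
    unfolding observation_law_def by (rule prob_space.prob_space_distr[OF p])
qed

end

theory Submission
  imports Defs "HOL-Real_Asymp.Real_Asymp"
begin

text \<open>
  The model is discrete. The signal is \<open>\<mu> k l = 2 h (k - l)\<close> with \<open>(2 h)\<^sup>2 = \<gamma> \<beta>\<^sup>2\<close> for a constant
  \<open>\<gamma>\<close> in \<open>{1<..M}\<close>, and the noise is \<open>Z i j = h (z i - z j)\<close>, where \<open>z\<close> is the difference
  \<open>e K - e L\<close> of two unit vectors for an ordered pair \<open>(K, L)\<close> of distinct indices drawn uniformly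
  at random.

  Estimation is hard because \<open>X i j = h ((2 r i + z i) - (2 r j + z j))\<close> depends on \<open>r\<close> and \<open>z\<close> only
  through \<open>2 r + z\<close>: the rank vector \<open>r\<close> with noise pair \<open>(K, L)\<close> and the rank vector
  \<open>r + e K - e L\<close> with noise pair \<open>(L, K)\<close> give the same observation (\<open>observe_move\<close>), and no
  estimator is right for both. Take the rank vectors in \<open>{1..n}\<close> whose sum is exactly \<open>1 + \<dots> + n\<close>;
  the move \<open>r \<mapsto> r + e K - e L\<close> preserves the sum and leaves the box only if \<open>r K = n\<close> or \<open>r L = 1\<close>.
  Each of these two events has proportion at most \<open>2 / (n + 2)\<close> (\<open>card_top_face_le\<close>), so every
  estimator fails, on average over these rank vectors, with probability at least
  \<open>1 / 2 - 2 / (n + 2)\<close> (\<open>exists_bad_rank\<close>).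

  The signal conditions are elementary: with \<open>d = r' - r\<close> the gap is
  \<open>(2 h)\<^sup>2 (2 n \<bar>d\<bar>\<^sup>2 - 2 (\<Sum>i. d i)\<^sup>2)\<close>, and \<open>\<bar>\<Sum>i. d i\<bar> \<le> 2 c = o(\<surd>n)\<close>.

  For the noise condition, a linear functional \<open>\<Sum>v Z\<close> with \<open>\<bar>v\<bar> = 1\<close> equals \<open>h (w K - w L)\<close> for a
  vector \<open>w\<close> with \<open>\<bar>w\<bar>\<^sup>2 \<le> 2 n\<close>. After the normalisation \<open>\<omega> = w / \<surd>(2 n)\<close> one has to count the pairs
  with \<open>\<omega> K - \<omega> L > x\<close> and compare their proportion with \<open>n powr (- (1 - \<delta>) x\<^sup>2)\<close>; this exponent is
  where the assumption on \<open>n \<beta>\<^sup>2 / (4 \<sigma>\<^sup>2 ln n)\<close> enters (\<open>big_gaps_fraction_le\<close>). Symmetry bounds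
  the proportion by \<open>1 / 2\<close>, which is enough for very small \<open>x\<close>; Chebyshev bounds it by about
  \<open>1 / (n x\<^sup>2)\<close>, which is enough for \<open>x\<^sup>2 \<le> 1 + \<delta> / 2\<close>; beyond that both \<open>\<omega> K\<close> and \<open>- \<omega> L\<close> are
  bounded away from 0, so only boundedly many pairs remain; and for \<open>x\<^sup>2 \<ge> 2\<close> there are none.
\<close>

section \<open>Sums over ordered pairs of distinct indices\<close>

lemma finite_offdiag [simp]: "finite (offdiag n)"
  by (rule finite_subset[of _ "{1..n} \<times> {1..n}"]) (auto simp: offdiag_def)

lemma offdiag_eq_Diff: "offdiag n = {1..n} \<times> {1..n} - (\<lambda>i. (i, i)) ` {1..n}"
  by (auto simp: offdiag_def)

lemma card_offdiag: "card (offdiag n) = n * (n - 1)"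
proof -
  have "card (offdiag n) = card ({1..n} \<times> {1..n}) - card ((\<lambda>i. (i, i)) ` {1..n})"
    unfolding offdiag_eq_Diff by (rule card_Diff_subset) auto
  also have "card ((\<lambda>i. (i, i)) ` {1..n}) = n"
    by (subst card_image) (auto simp: inj_on_def)
  finally show ?thesis by (simp add: card_cartesian_product algebra_simps)
qed

lemma offdiag_nonempty: "n \<ge> 2 \<Longrightarrow> offdiag n \<noteq> {}"
proof -
  assume "n \<ge> 2"
  then have "(1, 2) \<in> offdiag n" by (simp add: offdiag_def)
  then show ?thesis by blast
qed

lemma sum_offdiag_diff_sq:
  fixes x :: "nat \<Rightarrow> real"
  shows "(\<Sum>(i, j)\<in>offdiag n. (x i - x j)\<^sup>2)
           = 2 * real n * (\<Sum>i=1..n. (x i)\<^sup>2) - 2 * (\<Sum>i=1..n. x i)\<^sup>2"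
proof -
  have "(\<Sum>(i, j)\<in>offdiag n. (x i - x j)\<^sup>2) = (\<Sum>(i, j)\<in>{1..n} \<times> {1..n}. (x i - x j)\<^sup>2)"
    by (rule sum.mono_neutral_left) (auto simp: offdiag_def)
  also have "\<dots> = (\<Sum>i=1..n. \<Sum>j=1..n. (x i)\<^sup>2 + (x j)\<^sup>2 - 2 * (x i * x j))"
    by (simp add: sum.cartesian_product power2_diff algebra_simps)
  also have "\<dots> = 2 * real n * (\<Sum>i=1..n. (x i)\<^sup>2) - 2 * (\<Sum>i=1..n. \<Sum>j=1..n. x i * x j)"
    by (simp add: sum.distrib sum_subtractf flip: sum_distrib_left sum_distrib_right)
  also have "(\<Sum>i=1..n. \<Sum>j=1..n. x i * x j) = (\<Sum>i=1..n. x i)\<^sup>2"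
    by (simp add: power2_eq_square sum_product)
  finally show ?thesis .
qed

section \<open>The model\<close>

text \<open>The vector \<open>e K - e L\<close> for \<open>p = (K, L)\<close>.\<close>

definition unit_transfer :: "nat \<times> nat \<Rightarrow> nat \<Rightarrow> real" where
  "unit_transfer p i = of_bool (i = fst p) - of_bool (i = snd p)"

text \<open>The spacing is \<open>2 h\<close>, so that a noise step of size \<open>h\<close> leads halfway to a neighbouring rank.\<close>

definition diff_signal :: "real \<Rightarrow> nat \<Rightarrow> nat \<Rightarrow> real" where
  "diff_signal h k l = 2 * h * (real k - real l)"

text \<open>The law of \<open>h (z i - z j)\<close> for \<open>z = unit_transfer p\<close> and a uniformly distributed pair \<open>p\<close> of distinct
  indices. For \<open>n < 2\<close> there is no such pair, and \<open>pmf_of_set\<close> of the empty set is an unspecified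
  distribution; the law is still a probability measure.\<close>

definition pair_noise :: "nat \<Rightarrow> real \<Rightarrow> (nat \<times> nat \<Rightarrow> real) measure" where
  "pair_noise n h = distr (measure_pmf (pmf_of_set (offdiag n))) (obs_space n)
     (\<lambda>p. \<lambda>(i, j)\<in>offdiag n. h * (unit_transfer p i - unit_transfer p j))"

lemma measurable_pmf_obs_space [measurable]:
  "(\<lambda>p. \<lambda>(i, j)\<in>offdiag n. f p i j) \<in> measurable (measure_pmf q) (obs_space n)"
  by (auto simp: obs_space_def space_PiM)

lemma noise_distribution_pair_noise: "noise_distribution n (pair_noise n h)"
  unfolding noise_distribution_def pair_noise_def
  by (intro conjI prob_space.prob_space_distr measure_pmf.prob_space_axioms
        measurable_pmf_obs_space) simp

section \<open>The signal conditions\<close>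

lemma rank_dist_sq: "(rank_dist n r' r)\<^sup>2 = (\<Sum>i=1..n. (real (r' i) - real (r i))\<^sup>2)"
  unfolding rank_dist_def L2_set_def by (simp add: sum_nonneg)

lemma signal_gap_diff_signal:
  "signal_gap n (diff_signal h) r' r
     = (2 * h)\<^sup>2 * (2 * real n * (rank_dist n r' r)\<^sup>2
                    - 2 * (\<Sum>i=1..n. real (r' i) - real (r i))\<^sup>2)"
proof -
  define d where "d i = real (r' i) - real (r i)" for i
  have "signal_gap n (diff_signal h) r' r = (2 * h)\<^sup>2 * (\<Sum>(i, j)\<in>offdiag n. (d i - d j)\<^sup>2)"
    unfolding signal_gap_def sum_distrib_left
  proof (rule sum.cong)
    fix p assume "p \<in> offdiag n"
    obtain i j where p: "p = (i, j)" by (cases p)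
    have "diff_signal h (r' i) (r' j) - diff_signal h (r i) (r j) = 2 * h * (d i - d j)"
      by (simp add: diff_signal_def d_def algebra_simps)
    then show "(case p of (i, j) \<Rightarrow> (diff_signal h (r' i) (r' j) - diff_signal h (r i) (r j))\<^sup>2)
        = (2 * h)\<^sup>2 * (case p of (i, j) \<Rightarrow> (d i - d j)\<^sup>2)"
      by (simp only: p prod.case power_mult_distrib)
  qed simp
  then show ?thesis
    unfolding sum_offdiag_diff_sq rank_dist_sq d_def .
qed

text \<open>Rank vectors are integral, so distinct ones are at distance at least 1, and the bound \<open>2 c\<close> on the
  sum of the differences can be charged to their distance.\<close>

lemma rank_space_sum_diff_sq_le:
  assumes "r \<in> rank_space n c" "r' \<in> rank_space n c"
  shows "(\<Sum>i=1..n. real (r' i) - real (r i))\<^sup>2 \<le> 4 * c\<^sup>2 * (rank_dist n r' r)\<^sup>2"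
proof (cases "\<forall>i\<in>{1..n}. r' i = r i")
  case True
  then show ?thesis by simp
next
  case False
  then obtain k where k: "k \<in> {1..n}" "r' k \<noteq> r k" by blast
  have "1 \<le> \<bar>int (r' k) - int (r k)\<bar>" using k by linarith
  then have "1 \<le> \<bar>real (r' k) - real (r k)\<bar>" by linarith
  then have "1 \<le> (real (r' k) - real (r k))\<^sup>2"
    by (metis one_le_power power2_abs)
  also have "\<dots> \<le> (rank_dist n r' r)\<^sup>2"
    unfolding rank_dist_sq by (rule member_le_sum) (use k in auto)
  finally have Q: "1 \<le> (rank_dist n r' r)\<^sup>2" .
  have "\<bar>\<Sum>i=1..n. real (r' i) - real (r i)\<bar> \<le> 2 * c"
    using assms unfolding rank_space_def sum_subtractf by (auto simp: abs_le_iff)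
  then have "(\<Sum>i=1..n. real (r' i) - real (r i))\<^sup>2 \<le> (2 * c)\<^sup>2"
    by (metis abs_ge_zero power2_abs power_mono)
  also have "\<dots> \<le> 4 * c\<^sup>2 * (rank_dist n r' r)\<^sup>2"
    using mult_left_mono[OF Q, of "4 * c\<^sup>2"] by simp
  finally show ?thesis .
qed

lemma signal_condition_diff_signal:
  assumes h: "(2 * h)\<^sup>2 = \<gamma> * \<beta>\<^sup>2" and \<gamma>: "\<gamma> * (real n - 4 * c\<^sup>2) \<ge> real n"
  shows "signal_condition n c \<beta> (diff_signal h)"
  unfolding signal_condition_def
proof (intro ballI)
  fix r r' assume r: "r \<in> rank_space n c" "r' \<in> rank_space n c"
  define Q where "Q = (rank_dist n r' r)\<^sup>2"
  have "2 * real n * \<beta>\<^sup>2 * Q = (2 * \<beta>\<^sup>2 * Q) * real n" by simp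
  also have "\<dots> \<le> (2 * \<beta>\<^sup>2 * Q) * (\<gamma> * (real n - 4 * c\<^sup>2))"
    by (rule mult_left_mono[OF \<gamma>]) (simp add: Q_def)
  also have "\<dots> = (2 * h)\<^sup>2 * (2 * real n * Q - 2 * (4 * c\<^sup>2 * Q))"
    unfolding h by (simp add: algebra_simps)
  also have "\<dots> \<le> signal_gap n (diff_signal h) r' r"
    unfolding signal_gap_diff_signal Q_def
    using rank_space_sum_diff_sq_le[OF r] by (intro mult_left_mono) auto
  finally show "signal_gap n (diff_signal h) r' r \<ge> 2 * real n * \<beta>\<^sup>2 * (rank_dist n r' r)\<^sup>2"
    unfolding Q_def .
qed

lemma upper_signal_condition_diff_signal:
  assumes h: "(2 * h)\<^sup>2 = \<gamma> * \<beta>\<^sup>2" and \<gamma>: "\<gamma> \<le> M"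
  shows "upper_signal_condition n c M \<beta> (diff_signal h)"
  unfolding upper_signal_condition_def
proof (intro ballI)
  fix r r'
  have "signal_gap n (diff_signal h) r' r \<le> (2 * h)\<^sup>2 * (2 * real n * (rank_dist n r' r)\<^sup>2)"
    unfolding signal_gap_diff_signal by (intro mult_left_mono) auto
  also have "\<dots> = \<gamma> * (2 * real n * \<beta>\<^sup>2 * (rank_dist n r' r)\<^sup>2)"
    unfolding h by simp
  also have "\<dots> \<le> M * (2 * real n * \<beta>\<^sup>2 * (rank_dist n r' r)\<^sup>2)"
    using \<gamma> by (intro mult_right_mono) auto
  finally show "signal_gap n (diff_signal h) r' r \<le> 2 * M * real n * \<beta>\<^sup>2 * (rank_dist n r' r)\<^sup>2"
    by (simp add: algebra_simps)
qed

section \<open>The noise condition\<close>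

text \<open>The pairs \<open>(K, L)\<close> of distinct indices with \<open>\<omega> K - \<omega> L > x\<close>.\<close>

definition big_gaps :: "nat \<Rightarrow> (nat \<Rightarrow> real) \<Rightarrow> real \<Rightarrow> (nat \<times> nat) set" where
  "big_gaps n \<omega> x = {(K, L) \<in> offdiag n. \<omega> K - \<omega> L > x}"

lemma finite_big_gaps [simp]: "finite (big_gaps n \<omega> x)"
  by (rule finite_subset[of _ "offdiag n"]) (auto simp: big_gaps_def)

lemma card_big_gaps_swap: "card (prod.swap ` big_gaps n \<omega> x) = card (big_gaps n \<omega> x)"
  by (rule card_image) simp

text \<open>A pair and its reversal cannot both have a big gap.\<close>

lemma card_big_gaps_le_half:
  assumes "x > 0"
  shows "2 * card (big_gaps n \<omega> x) \<le> card (offdiag n)"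
proof -
  have "card (big_gaps n \<omega> x \<union> prod.swap ` big_gaps n \<omega> x) \<le> card (offdiag n)"
    by (rule card_mono[OF finite_offdiag]) (auto simp: big_gaps_def offdiag_def)
  moreover have "big_gaps n \<omega> x \<inter> prod.swap ` big_gaps n \<omega> x = {}"
    using assms by (auto simp: big_gaps_def)
  ultimately show ?thesis
    by (simp add: card_Un_disjoint card_big_gaps_swap)
qed

text \<open>Chebyshev's inequality; the usual bound \<open>2 n\<close> is halved because each pair is counted together with
  its reversal.\<close>

lemma card_big_gaps_Chebyshev:
  assumes "x > 0" and \<omega>: "(\<Sum>k=1..n. (\<omega> k)\<^sup>2) \<le> 1"
  shows "real (card (big_gaps n \<omega> x)) * x\<^sup>2 \<le> real n"
proof -
  let ?B = "big_gaps n \<omega> x" and ?f = "\<lambda>(i, j). (\<omega> i - \<omega> j)\<^sup>2"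
  have disj: "?B \<inter> prod.swap ` ?B = {}"
    using assms by (auto simp: big_gaps_def)
  have "2 * (real (card ?B) * x\<^sup>2) = (\<Sum>p\<in>?B \<union> prod.swap ` ?B. x\<^sup>2)"
    by (simp add: card_Un_disjoint[OF _ _ disj] card_big_gaps_swap)
  also have "\<dots> \<le> (\<Sum>p\<in>?B \<union> prod.swap ` ?B. ?f p)"
  proof (rule sum_mono)
    fix p assume "p \<in> ?B \<union> prod.swap ` ?B"
    then have "x \<le> \<bar>\<omega> (fst p) - \<omega> (snd p)\<bar>" by (auto simp: big_gaps_def)
    then show "x\<^sup>2 \<le> ?f p"
      using \<open>x > 0\<close> by (cases p) (auto simp: abs_le_square_iff[symmetric])
  qed
  also have "\<dots> \<le> (\<Sum>p\<in>offdiag n. ?f p)"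
    by (rule sum_mono2[OF finite_offdiag]) (auto simp: big_gaps_def offdiag_def)
  also have "\<dots> \<le> 2 * real n * (\<Sum>k=1..n. (\<omega> k)\<^sup>2)"
    unfolding sum_offdiag_diff_sq by simp
  also have "\<dots> \<le> 2 * real n * 1"
    by (rule mult_left_mono[OF \<omega>]) simp
  finally show ?thesis by simp
qed

text \<open>All entries of \<open>\<omega>\<close> are at most 1 in absolute value, so a gap above \<open>1 + \<eta>\<close> needs two entries of
  absolute value at least \<open>\<eta>\<close>, and there are at most \<open>1 / \<eta>\<^sup>2\<close> such entries.\<close>

lemma card_big_gaps_le_of_ge_1:
  assumes \<eta>: "\<eta> > 0" "x \<ge> 1 + \<eta>" and \<omega>: "(\<Sum>k=1..n. (\<omega> k)\<^sup>2) \<le> 1"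
  shows "real (card (big_gaps n \<omega> x)) \<le> 1 / \<eta> ^ 4"
proof -
  define S where "S = {k \<in> {1..n}. \<eta> \<le> \<bar>\<omega> k\<bar>}"
  have le1: "\<bar>\<omega> k\<bar> \<le> 1" if "k \<in> {1..n}" for k
  proof -
    have "(\<omega> k)\<^sup>2 \<le> (\<Sum>k=1..n. (\<omega> k)\<^sup>2)" by (rule member_le_sum) (use that in auto)
    also note \<omega>
    finally show ?thesis by (simp add: abs_square_le_1)
  qed
  have "big_gaps n \<omega> x \<subseteq> S \<times> S"
  proof
    fix p assume "p \<in> big_gaps n \<omega> x"
    then obtain K L where p: "p = (K, L)" "K \<in> {1..n}" "L \<in> {1..n}" "\<omega> K - \<omega> L > x"
      by (auto simp: big_gaps_def offdiag_def)
    then show "p \<in> S \<times> S"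
      using le1[of K] le1[of L] \<eta> by (auto simp: S_def abs_le_iff)
  qed
  then have "card (big_gaps n \<omega> x) \<le> card (S \<times> S)"
    by (intro card_mono) (auto simp: S_def)
  then have c: "real (card (big_gaps n \<omega> x)) \<le> (real (card S))\<^sup>2"
    by (simp add: card_cartesian_product power2_eq_square flip: of_nat_mult)
  have "real (card S) * \<eta>\<^sup>2 = (\<Sum>k\<in>S. \<eta>\<^sup>2)" by simp
  also have "\<dots> \<le> (\<Sum>k\<in>S. (\<omega> k)\<^sup>2)"
    using \<eta> by (intro sum_mono) (auto simp: S_def abs_le_square_iff[symmetric])
  also have "\<dots> \<le> (\<Sum>k=1..n. (\<omega> k)\<^sup>2)"
    by (rule sum_mono2) (auto simp: S_def)
  finally have "real (card S) * \<eta>\<^sup>2 \<le> 1" using \<omega> by simp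
  then have "real (card S) \<le> 1 / \<eta>\<^sup>2" using \<eta> by (simp add: field_simps)
  then have "(real (card S))\<^sup>2 \<le> (1 / \<eta>\<^sup>2)\<^sup>2" by (rule power_mono) simp
  also have "(1 / \<eta>\<^sup>2)\<^sup>2 = 1 / \<eta> ^ 4" by (simp add: power_divide flip: power_mult)
  finally show ?thesis using c by linarith
qed

lemma big_gaps_empty:
  assumes "x\<^sup>2 \<ge> 2" "x > 0" and \<omega>: "(\<Sum>k=1..n. (\<omega> k)\<^sup>2) \<le> 1"
  shows "big_gaps n \<omega> x = {}"
proof (rule ccontr)
  assume "\<not> ?thesis"
  then obtain K L where KL: "K \<in> {1..n}" "L \<in> {1..n}" "K \<noteq> L" "\<omega> K - \<omega> L > x"
    by (auto simp: big_gaps_def offdiag_def)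
  have "(\<Sum>k\<in>{K, L}. (\<omega> k)\<^sup>2) \<le> (\<Sum>k=1..n. (\<omega> k)\<^sup>2)"
    by (rule sum_mono2) (use KL in auto)
  then have le1: "(\<omega> K)\<^sup>2 + (\<omega> L)\<^sup>2 \<le> 1" using \<omega> KL by simp
  have "x\<^sup>2 < (\<omega> K - \<omega> L)\<^sup>2" using KL assms by (intro power_strict_mono) auto
  also have "\<dots> \<le> 2 * ((\<omega> K)\<^sup>2 + (\<omega> L)\<^sup>2)"
    using zero_le_power2[of "\<omega> K + \<omega> L"] by (simp add: power2_sum power2_diff)
  also have "\<dots> \<le> 2" using le1 by simp
  finally have "x\<^sup>2 < 2" .
  with \<open>x\<^sup>2 \<ge> 2\<close> show False by simp
qed

text \<open>The tail estimate behind the noise condition. The assumptions \<open>mid\<close> and \<open>large\<close> hold for all large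
  \<open>n\<close>; they serve the ranges of intermediate and of large \<open>x\<close>.\<close>

lemma big_gaps_fraction_le:
  assumes n: "n \<ge> 2" and \<delta>: "0 < \<delta>" "\<delta> < 1"
    and mid: "ln n / (ln 2 * (real n - 1)) \<le> real n powr (- (1 - \<delta> / 2))"
    and large: "(8 / \<delta>) ^ 4 / (real n * (real n - 1)) \<le> real n powr (- (2 * (1 - \<delta>)))"
    and E: "E \<le> (1 - \<delta>) * ln n"
    and x: "x > 0" and \<omega>: "(\<Sum>k=1..n. (\<omega> k)\<^sup>2) \<le> 1"
  shows "real (card (big_gaps n \<omega> x)) / real (card (offdiag n)) \<le> exp (- (E * x\<^sup>2))"
proof -
  let ?c = "real (card (big_gaps n \<omega> x))"
  have N: "real (card (offdiag n)) = real n * (real n - 1)"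
    using n by (simp add: card_offdiag of_nat_diff)
  have Npos: "real n * (real n - 1) > 0" using n by simp
  have lnpos: "ln (real n) > 0" using n by simp
  have "E * x\<^sup>2 \<le> (1 - \<delta>) * ln n * x\<^sup>2" using E by (rule mult_right_mono) simp
  then have E_le: "exp (- ((1 - \<delta>) * ln n * x\<^sup>2)) \<le> exp (- (E * x\<^sup>2))" by simp
  have pw: "real n powr a = exp (a * ln n)" for a using n by (simp add: powr_def)
  consider "x\<^sup>2 * ln n \<le> ln 2" | "x\<^sup>2 * ln n > ln 2" "x\<^sup>2 \<le> 1 + \<delta> / 2"
    | "x\<^sup>2 > 1 + \<delta> / 2" "x\<^sup>2 < 2" | "x\<^sup>2 \<ge> 2" by linarith
  then have "?c / (real n * (real n - 1)) \<le> exp (- ((1 - \<delta>) * ln n * x\<^sup>2))"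
  proof cases
    case 1
    have "2 * ?c \<le> real n * (real n - 1)"
      using card_big_gaps_le_half[OF x, of n \<omega>] N by linarith
    then have "?c / (real n * (real n - 1)) \<le> 1 / 2" using Npos by (simp add: field_simps)
    also have "\<dots> = exp (- ln 2)" by (simp add: exp_minus)
    also have "\<dots> \<le> exp (- ((1 - \<delta>) * ln n * x\<^sup>2))"
    proof -
      have "(1 - \<delta>) * (x\<^sup>2 * ln n) \<le> 1 * (x\<^sup>2 * ln n)"
        using \<delta> lnpos by (intro mult_right_mono) auto
      with 1 show ?thesis by (simp add: algebra_simps)
    qed
    finally show ?thesis .
  next
    case 2
    have "?c * x\<^sup>2 \<le> real n" by (rule card_big_gaps_Chebyshev[OF x \<omega>])
    then have "?c * ln 2 \<le> real n * ln n"
    proof -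
      have "?c * ln 2 \<le> ?c * (x\<^sup>2 * ln n)" using 2 by (intro mult_left_mono) auto
      also have "\<dots> = (?c * x\<^sup>2) * ln n" by simp
      also have "\<dots> \<le> real n * ln n"
        using lnpos by (intro mult_right_mono[OF \<open>?c * x\<^sup>2 \<le> real n\<close>]) simp
      finally show ?thesis .
    qed
    then have "?c / real n \<le> ln n / ln 2"
      using n by (simp add: field_simps)
    then have "?c / real n / (real n - 1) \<le> ln n / ln 2 / (real n - 1)"
      using n by (intro divide_right_mono) auto
    then have "?c / (real n * (real n - 1)) \<le> ln n / (ln 2 * (real n - 1))"
      by (simp only: divide_divide_eq_left)
    also note mid
    also have "real n powr (- (1 - \<delta> / 2)) \<le> exp (- ((1 - \<delta>) * ln n * x\<^sup>2))"
    proof -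
      have "(1 - \<delta>) * x\<^sup>2 \<le> (1 - \<delta>) * (1 + \<delta> / 2)"
        using 2 \<delta> by (intro mult_left_mono) auto
      also have "\<dots> \<le> 1 - \<delta> / 2" using \<delta> by (simp add: algebra_simps)
      finally have "(1 - \<delta>) * x\<^sup>2 * ln n \<le> (1 - \<delta> / 2) * ln n"
        using lnpos by (intro mult_right_mono) auto
      then show ?thesis unfolding pw by (simp add: algebra_simps)
    qed
    finally show ?thesis .
  next
    case 3
    (* The gap exceeds 1 by at least delta / 8, which makes the number of pairs bounded. *)
    have "(1 + \<delta> / 8)\<^sup>2 \<le> 1 + \<delta> / 2"
    proof -
      have "\<delta> * \<delta> \<le> 1 * \<delta>" using \<delta> by (intro mult_right_mono) auto
      moreover have "(1 + \<delta> / 8)\<^sup>2 = 1 + \<delta> / 4 + \<delta> * \<delta> / 64"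
        by (simp add: power2_eq_square algebra_simps)
      ultimately show ?thesis using \<delta> by linarith
    qed
    with 3 have "(1 + \<delta> / 8)\<^sup>2 \<le> x\<^sup>2" by linarith
    then have "1 + \<delta> / 8 \<le> x" by (rule power2_le_imp_le) (use x in simp)
    then have "?c \<le> 1 / (\<delta> / 8) ^ 4"
      using \<delta> \<omega> by (intro card_big_gaps_le_of_ge_1) auto
    then have "?c \<le> (8 / \<delta>) ^ 4" by (simp add: power_divide)
    then have "?c / (real n * (real n - 1)) \<le> (8 / \<delta>) ^ 4 / (real n * (real n - 1))"
      using Npos by (intro divide_right_mono) auto
    also note large
    also have "real n powr (- (2 * (1 - \<delta>))) \<le> exp (- ((1 - \<delta>) * ln n * x\<^sup>2))"
    proof -
      have "(1 - \<delta>) * ln n * x\<^sup>2 \<le> (1 - \<delta>) * ln n * 2"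
        using 3 \<delta> lnpos by (intro mult_left_mono) auto
      then show ?thesis unfolding pw by (simp add: algebra_simps)
    qed
    finally show ?thesis .
  next
    case 4
    then show ?thesis using big_gaps_empty[OF 4 x \<omega>] by simp
  qed
  with E_le show ?thesis unfolding N by linarith
qed

text \<open>The coefficient of \<open>x k\<close> in the linear form \<open>\<Sum>(i, j). v (i, j) (x i - x j)\<close>, that is, the adjoint
  of the map \<open>x \<mapsto> (x i - x j)\<close> applied to \<open>v\<close>.\<close>

definition net_weight :: "nat \<Rightarrow> (nat \<times> nat \<Rightarrow> real) \<Rightarrow> nat \<Rightarrow> real" where
  "net_weight n v k = (\<Sum>(i, j)\<in>offdiag n. v (i, j) * (of_bool (i = k) - of_bool (j = k)))"

lemma sum_mult_of_bool_eq:
  fixes x :: "nat \<Rightarrow> real"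
  assumes "finite S"
  shows "(\<Sum>k\<in>S. x k * of_bool (i = k)) = (if i \<in> S then x i else 0)"
proof -
  have "(\<Sum>k\<in>S. x k * of_bool (i = k)) = (\<Sum>k\<in>S. if i = k then x k else 0)"
    by (rule sum.cong) auto
  then show ?thesis using assms by simp
qed

lemma sum_net_weight:
  "(\<Sum>k=1..n. x k * net_weight n v k) = (\<Sum>(i, j)\<in>offdiag n. v (i, j) * (x i - x j))"
proof -
  have "(\<Sum>k=1..n. x k * net_weight n v k)
      = (\<Sum>(i, j)\<in>offdiag n. v (i, j) * (\<Sum>k=1..n. x k * (of_bool (i = k) - of_bool (j = k))))"
    unfolding net_weight_def sum_distrib_left
    by (subst sum.swap) (auto intro!: sum.cong simp: algebra_simps)
  also have "\<dots> = (\<Sum>(i, j)\<in>offdiag n. v (i, j) * (x i - x j))"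
    by (rule sum.cong)
       (auto simp: offdiag_def right_diff_distrib sum_subtractf sum_mult_of_bool_eq)
  finally show ?thesis .
qed

text \<open>The adjoint has the same operator norm as \<open>x \<mapsto> (x i - x j)\<close>, which is at most \<open>\<surd>(2 n)\<close> by
  \<open>sum_offdiag_diff_sq\<close>.\<close>

lemma sum_net_weight_sq_le:
  assumes "(\<Sum>p\<in>offdiag n. (v p)\<^sup>2) = 1"
  shows "(\<Sum>k=1..n. (net_weight n v k)\<^sup>2) \<le> 2 * real n"
proof -
  let ?w = "net_weight n v"
  define W where "W = (\<Sum>k=1..n. (?w k)\<^sup>2)"
  (* Pairing w with itself gives a sum against v, to which Cauchy-Schwarz applies. *)
  have "W = (\<Sum>p\<in>offdiag n. v p * (?w (fst p) - ?w (snd p)))"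
    using sum_net_weight[where x = ?w] by (simp add: W_def power2_eq_square case_prod_unfold)
  then have "W\<^sup>2 \<le> (\<Sum>p\<in>offdiag n. (v p)\<^sup>2) * (\<Sum>p\<in>offdiag n. (?w (fst p) - ?w (snd p))\<^sup>2)"
    using Cauchy_Schwarz_ineq_sum by metis
  also have "\<dots> = 2 * real n * W - 2 * (\<Sum>k=1..n. ?w k)\<^sup>2"
    using sum_offdiag_diff_sq[of ?w n] assms by (simp add: W_def case_prod_unfold)
  also have "\<dots> \<le> 2 * real n * W" by simp
  finally have "W * W \<le> 2 * real n * W" by (simp add: power2_eq_square)
  moreover have "W \<ge> 0" by (simp add: W_def sum_nonneg)
  ultimately show ?thesis
    unfolding W_def[symmetric] by (cases "W = 0") (auto simp: mult_le_cancel_right)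
qed

lemma sum_unit_transfer:
  assumes "p \<in> offdiag n"
  shows "(\<Sum>(i, j)\<in>offdiag n. v (i, j) * (unit_transfer p i - unit_transfer p j))
           = net_weight n v (fst p) - net_weight n v (snd p)"
proof -
  have "(\<Sum>(i, j)\<in>offdiag n. v (i, j) * (unit_transfer p i - unit_transfer p j))
      = (\<Sum>k=1..n. net_weight n v k * of_bool (fst p = k))
        - (\<Sum>k=1..n. net_weight n v k * of_bool (snd p = k))"
    unfolding sum_net_weight[symmetric] sum_subtractf[symmetric]
    by (rule sum.cong) (auto simp: unit_transfer_def)
  also have "\<dots> = net_weight n v (fst p) - net_weight n v (snd p)"
    using assms by (auto simp: offdiag_def sum_mult_of_bool_eq)
  finally show ?thesis .
qed

lemma measure_pair_noise:
  assumes "n \<ge> 2" "{z \<in> space (obs_space n). P z} \<in> sets (obs_space n)"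
  shows "measure (pair_noise n h) {z \<in> space (pair_noise n h). P z}
     = real (card {p \<in> offdiag n. P (\<lambda>(i, j)\<in>offdiag n. h * (unit_transfer p i - unit_transfer p j))})
         / real (card (offdiag n))"
proof -
  have sp: "(\<lambda>(i, j)\<in>offdiag n. h * (unit_transfer p i - unit_transfer p j)) \<in> space (obs_space n)" for p
    by (auto simp: obs_space_def space_PiM)
  show ?thesis
    using assms offdiag_nonempty[of n]
    by (simp add: pair_noise_def measure_distr vimage_def sp measure_pmf_of_set Int_def)
qed

lemma noise_condition_pair_noise:
  assumes n: "n \<ge> 2" and \<delta>: "0 < \<delta>" "\<delta> < 1" and h: "h \<ge> 0"
    and mid: "ln n / (ln 2 * (real n - 1)) \<le> real n powr (- (1 - \<delta> / 2))"
    and large: "(8 / \<delta>) ^ 4 / (real n * (real n - 1)) \<le> real n powr (- (2 * (1 - \<delta>)))"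
    and \<sigma>: "\<sigma> > 0" and E: "real n * h\<^sup>2 / \<sigma>\<^sup>2 \<le> (1 - \<delta>) * ln n"
  shows "noise_condition n \<sigma> (pair_noise n h)"
  unfolding noise_condition_def
proof (intro allI impI)
  fix t :: real and v :: "nat \<times> nat \<Rightarrow> real"
  assume t: "t > 0" and v: "(\<Sum>p\<in>offdiag n. (v p)\<^sup>2) = 1"
  let ?w = "net_weight n v"
  have meas: "{z \<in> space (obs_space n). (\<Sum>p\<in>offdiag n. v p * z p) > t} \<in> sets (obs_space n)"
    unfolding obs_space_def by measurable
  have proj: "(\<Sum>q\<in>offdiag n. v q * (\<lambda>(i, j)\<in>offdiag n. h * (unit_transfer p i - unit_transfer p j)) q)
      = h * (?w (fst p) - ?w (snd p))" if "p \<in> offdiag n" for p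
    using sum_unit_transfer[OF that, of v]
    by (simp add: case_prod_unfold sum_distrib_left[symmetric] mult.left_commute[of _ h])
  have eq: "measure (pair_noise n h) {z \<in> space (pair_noise n h). (\<Sum>p\<in>offdiag n. v p * z p) > t}
      = real (card {p \<in> offdiag n. h * (?w (fst p) - ?w (snd p)) > t}) / real (card (offdiag n))"
    unfolding measure_pair_noise[OF n meas]
    by (intro arg_cong[where f = "\<lambda>S. real (card S) / _"]) (use proj in auto)
  show "measure (pair_noise n h) {z \<in> space (pair_noise n h). (\<Sum>p\<in>offdiag n. v p * z p) > t}
      \<le> exp (- (t\<^sup>2 / (2 * \<sigma>\<^sup>2)))"
  proof (cases "h = 0")
    case True
    with t show ?thesis unfolding eq by simp
  next
    case False
    with h have h: "h > 0" by simp
    define s where "s = sqrt (2 * real n)"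
    have s: "s > 0" "s\<^sup>2 = 2 * real n" using n by (auto simp: s_def)
    define \<omega> where "\<omega> k = ?w k / s" for k
    define x where "x = t / (h * s)"
    have x: "x > 0" using t h s by (simp add: x_def)
    have \<omega>: "(\<Sum>k=1..n. (\<omega> k)\<^sup>2) \<le> 1"
      using sum_net_weight_sq_le[OF v] n
      by (simp add: \<omega>_def power_divide s sum_divide_distrib[symmetric])
    have "{p \<in> offdiag n. h * (?w (fst p) - ?w (snd p)) > t} = big_gaps n \<omega> x"
      using h s by (auto simp: big_gaps_def \<omega>_def x_def field_simps)
    then have "measure (pair_noise n h) {z \<in> space (pair_noise n h). (\<Sum>p\<in>offdiag n. v p * z p) > t}
        \<le> exp (- ((real n * h\<^sup>2 / \<sigma>\<^sup>2) * x\<^sup>2))"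
      unfolding eq using big_gaps_fraction_le[OF n \<delta> mid large E x \<omega>] by simp
    also have "(real n * h\<^sup>2 / \<sigma>\<^sup>2) * x\<^sup>2 = t\<^sup>2 / (2 * \<sigma>\<^sup>2)"
      using h s \<sigma> n by (simp add: x_def power_divide power_mult_distrib field_simps)
    finally show ?thesis .
  qed
qed

section \<open>Balanced rank vectors and the boundary of the box\<close>

text \<open>The rank vectors whose sum is exactly \<open>1 + \<dots> + n\<close>.\<close>

definition balanced :: "nat \<Rightarrow> (nat \<Rightarrow> nat) set" where
  "balanced n = {r \<in> ranks n. (\<Sum>i=1..n. r i) = (\<Sum>i=1..n. i)}"

lemma finite_balanced [simp]: "finite (balanced n)"
  by (rule finite_subset[of _ "ranks n"]) (auto simp: balanced_def ranks_def intro!: finite_PiE)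

lemma balanced_nonempty: "balanced n \<noteq> {}"
proof -
  have "(\<lambda>i\<in>{1..n}. i) \<in> balanced n"
    by (auto simp: balanced_def ranks_def)
  then show ?thesis by blast
qed

lemma balanced_subset_rank_space:
  assumes "c \<ge> 0"
  shows "balanced n \<subseteq> rank_space n c"
proof
  fix r assume r: "r \<in> balanced n"
  then have "real (\<Sum>i=1..n. r i) = real (\<Sum>i=1..n. i)" by (simp add: balanced_def)
  then have "(\<Sum>i=1..n. real (r i)) = (\<Sum>i=1..n. real i)" unfolding of_nat_sum .
  with r assms show "r \<in> rank_space n c" by (simp add: balanced_def rank_space_def)
qed

lemma balanced_range:
  assumes "r \<in> balanced n" "i \<in> {1..n}"
  shows "1 \<le> r i" "r i \<le> n"
  using assms by (auto simp: balanced_def ranks_def PiE_def Pi_def)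

lemma sum_fun_upd2:
  fixes r :: "nat \<Rightarrow> nat"
  assumes "(K, L) \<in> offdiag n"
  shows "(\<Sum>i=1..n. (r(K := a, L := b)) i) + r K + r L = (\<Sum>i=1..n. r i) + a + b"
proof -
  have KL: "K \<in> {1..n}" "L \<in> {1..n} - {K}" using assms by (auto simp: offdiag_def)
  have *: "(\<Sum>i=1..n. f i) = f K + (f L + (\<Sum>i\<in>{1..n} - {K} - {L}. f i))" for f :: "nat \<Rightarrow> nat"
    using KL by (simp add: sum.remove)
  have "(\<Sum>i\<in>{1..n} - {K} - {L}. (r(K := a, L := b)) i) = (\<Sum>i\<in>{1..n} - {K} - {L}. r i)"
    by (rule sum.cong) auto
  then show ?thesis
    unfolding *[of r] *[of "r(K := a, L := b)"] using KL by simp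
qed

lemma fun_upd2_balanced:
  assumes r: "r \<in> balanced n" and KL: "(K, L) \<in> offdiag n"
    and "a + b = r K + r L" "a \<in> {1..n}" "b \<in> {1..n}"
  shows "r(K := a, L := b) \<in> balanced n"
proof -
  have "(\<Sum>i=1..n. (r(K := a, L := b)) i) = (\<Sum>i=1..n. r i)"
    using sum_fun_upd2[OF KL, of r a b] assms by simp
  moreover have "r(K := a, L := b) \<in> ranks n"
    using assms unfolding balanced_def ranks_def PiE_def Pi_def extensional_def offdiag_def by auto
  ultimately show ?thesis using r by (simp add: balanced_def)
qed

text \<open>The balanced vectors in which coordinate \<open>K\<close> cannot be raised, and those in which it cannot be
  lowered, without leaving \<open>{1..n}\<close>.\<close>

definition top_face :: "nat \<Rightarrow> nat \<Rightarrow> (nat \<Rightarrow> nat) set" where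
  "top_face n K = {r \<in> balanced n. r K = n}"

definition bottom_face :: "nat \<Rightarrow> nat \<Rightarrow> (nat \<Rightarrow> nat) set" where
  "bottom_face n K = {r \<in> balanced n. r K = 1}"

lemma finite_faces [simp]: "finite (top_face n K)" "finite (bottom_face n K)"
  by (simp_all add: top_face_def bottom_face_def)

text \<open>Double counting. From a vector \<open>r\<close> with \<open>r K = n\<close> one may transfer any amount \<open>t \<le> n - r L\<close> from
  \<open>K\<close> to any other coordinate \<open>L\<close>. As the sum of \<open>r\<close> is fixed, each \<open>r\<close> admits the same number
  \<open>(n - 1) (n + 2) / 2\<close> of choices of \<open>(L, t)\<close>. The result and \<open>L\<close> determine \<open>t\<close> and \<open>r\<close>, so there are
  at most \<open>(n - 1) * card (balanced n)\<close> such transfers altogether.\<close>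

lemma card_top_face_le:
  assumes K: "K \<in> {1..n}" and n: "n \<ge> 2"
  shows "real (card (top_face n K)) * (real n + 2) \<le> 2 * real (card (balanced n))"
proof -
  let ?Ls = "{1..n} - {K}"
  define D where "D = (SIGMA r:top_face n K. SIGMA L:?Ls. {0..n - r L})"
  define f where "f = (\<lambda>(r :: nat \<Rightarrow> nat, L :: nat, t :: nat). (r(K := n - t, L := r L + t), L))"
  have rng: "1 \<le> r L" "r L \<le> n" if "r \<in> top_face n K" "L \<in> {1..n}" for r L
    using that balanced_range[of r n L] by (auto simp: top_face_def)
  have inner: "(\<Sum>L\<in>?Ls. real (n - r L + 1)) = (real n - 1) * (real n + 2) / 2"
    if r: "r \<in> top_face n K" for r
  proof -
    have "real (\<Sum>i=1..n. r i) = real (\<Sum>i=1..n. i)"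
      using r by (simp add: top_face_def balanced_def)
    then have S: "(\<Sum>i=1..n. real (r i)) = real n * (real n + 1) / 2"
      using double_gauss_sum_from_Suc_0[of n, where 'a = real] unfolding of_nat_sum by simp
    have "(\<Sum>i=1..n. real (r i)) = real (r K) + (\<Sum>L\<in>?Ls. real (r L))"
      using K by (simp add: sum.remove)
    then have R: "(\<Sum>L\<in>?Ls. real (r L)) = real n * (real n + 1) / 2 - real n"
      using r S by (simp add: top_face_def)
    have "(\<Sum>L\<in>?Ls. real (n - r L + 1)) = (\<Sum>L\<in>?Ls. (real n + 1) - real (r L))"
      by (rule sum.cong) (use rng[OF r] in \<open>auto simp: of_nat_diff\<close>)
    also have "\<dots> = (real n - 1) * (real n + 1) - (\<Sum>L\<in>?Ls. real (r L))"
      using K n by (simp add: sum_subtractf of_nat_diff)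
    also have "\<dots> = (real n - 1) * (real n + 2) / 2"
      unfolding R by (simp add: field_simps)
    finally show ?thesis .
  qed
  have finD: "finite D" unfolding D_def by (intro finite_SigmaI) auto
  have "card D = (\<Sum>r\<in>top_face n K. \<Sum>L\<in>?Ls. n - r L + 1)"
    unfolding D_def by (simp add: card_SigmaI finite_SigmaI)
  then have cardD: "real (card D) = real (card (top_face n K)) * ((real n - 1) * (real n + 2) / 2)"
    by (simp only: of_nat_sum inner sum_constant cong: sum.cong)
  have "inj_on f D"
  proof (rule inj_onI)
    fix x y assume xy: "x \<in> D" "y \<in> D" "f x = f y"
    obtain r L t where x: "x = (r, L, t)" by (cases x)
    obtain r' L' t' where y: "y = (r', L', t')" by (cases y)
    have L: "L' = L" "L \<noteq> K" "r K = n" "r' K = n" "L \<in> {1..n}"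
      and tn: "t \<le> n - r L" "t' \<le> n - r' L"
      and eq: "r(K := n - t, L := r L + t) = r'(K := n - t', L := r' L + t')"
      using xy unfolding x y D_def f_def by (auto simp: top_face_def)
    have "n - t = n - t'" using fun_cong[OF eq, of K] L by simp
    then have t: "t = t'" using tn by linarith
    have "r L = r' L" using fun_cong[OF eq, of L] t by simp
    moreover have "r k = r' k" if "k \<noteq> K" "k \<noteq> L" for k
      using fun_cong[OF eq, of k] that by simp
    ultimately have "r = r'" using L by (metis ext)
    then show "x = y" using x y L t by simp
  qed
  moreover have "f ` D \<subseteq> balanced n \<times> ?Ls"
  proof
    fix y assume "y \<in> f ` D"
    then obtain x where "x \<in> D" "y = f x" by blast
    moreover obtain r L t where "x = (r, L, t)" by (cases x)
    ultimately have r: "r \<in> top_face n K" and L: "L \<in> ?Ls" and t: "t \<le> n - r L"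
      and y: "y = (r(K := n - t, L := r L + t), L)"
      unfolding D_def f_def by auto
    have "(K, L) \<in> offdiag n" using K L by (auto simp: offdiag_def)
    then have "r(K := n - t, L := r L + t) \<in> balanced n"
      using r L t rng[of r L] by (intro fun_upd2_balanced) (auto simp: top_face_def)
    then show "y \<in> balanced n \<times> ?Ls" using L y by simp
  qed
  ultimately have "card D \<le> card (balanced n \<times> ?Ls)"
    by (intro card_inj_on_le) auto
  also have "\<dots> = card (balanced n) * (n - 1)"
    using K by (simp add: card_cartesian_product)
  finally have "real (card D) \<le> real (card (balanced n) * (n - 1))"
    by (simp only: of_nat_le_iff)
  also have "\<dots> = real (card (balanced n)) * (real n - 1)"
    using n by (simp add: of_nat_diff)
  finally have "(real n - 1) * (real (card (top_face n K)) * (real n + 2))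
      \<le> (real n - 1) * (2 * real (card (balanced n)))"
    unfolding cardD by (simp add: mult_ac)
  then show ?thesis using n by (simp only: mult_le_cancel_left_pos)
qed

text \<open>The reflection \<open>r \<mapsto> n + 1 - r\<close> preserves balanced vectors and exchanges the two faces.\<close>

lemma card_bottom_face_le:
  assumes K: "K \<in> {1..n}"
  shows "card (bottom_face n K) \<le> card (top_face n K)"
proof (rule card_inj_on_le)
  let ?f = "\<lambda>r. \<lambda>i\<in>{1..n}. n + 1 - r i"
  show "inj_on ?f (bottom_face n K)"
  proof (rule inj_onI, rule ext)
    fix r r' i assume r: "r \<in> bottom_face n K" "r' \<in> bottom_face n K" and eq: "?f r = ?f r'"
    show "r i = r' i"
    proof (cases "i \<in> {1..n}")
      case True
      then have "n + 1 - r i = n + 1 - r' i" using fun_cong[OF eq, of i] by simp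
      then show ?thesis
        using r True balanced_range[of r n i] balanced_range[of r' n i]
        by (auto simp: bottom_face_def)
    next
      case False
      then show ?thesis
        using r by (auto simp: bottom_face_def balanced_def ranks_def PiE_def extensional_def)
    qed
  qed
  show "?f ` bottom_face n K \<subseteq> top_face n K"
  proof
    fix s assume "s \<in> ?f ` bottom_face n K"
    then obtain r where r: "r \<in> balanced n" "r K = 1" and s: "s = ?f r"
      by (auto simp: bottom_face_def)
    have "(\<Sum>i=1..n. s i) + (\<Sum>i=1..n. r i) = (\<Sum>i=1..n. n + 1)"
      unfolding sum.distrib[symmetric]
    proof (rule sum.cong)
      fix i assume "i \<in> {1..n}"
      then show "s i + r i = n + 1" using balanced_range(2)[OF r(1), of i] by (simp add: s)
    qed simp
    also have "\<dots> = (\<Sum>i=1..n. i) + (\<Sum>i=1..n. i)"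
      using double_gauss_sum_from_Suc_0[of n, where 'a = nat] by simp
    finally have "(\<Sum>i=1..n. s i) = (\<Sum>i=1..n. i)"
      using r by (simp add: balanced_def)
    moreover have "s \<in> ranks n"
      using balanced_range[OF r(1)] by (fastforce simp: s ranks_def)
    ultimately show "s \<in> top_face n K" using r K by (simp add: top_face_def balanced_def s)
  qed
qed simp

section \<open>Failure of every estimator\<close>

text \<open>The array that is observed when the ranks are \<open>r\<close> and the noise pair is \<open>p\<close>.\<close>

definition observe :: "nat \<Rightarrow> real \<Rightarrow> (nat \<Rightarrow> nat) \<Rightarrow> nat \<times> nat \<Rightarrow> nat \<times> nat \<Rightarrow> real" where
  "observe n h r p = (\<lambda>(i, j)\<in>offdiag n.
     diff_signal h (r i) (r j) + h * (unit_transfer p i - unit_transfer p j))"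

text \<open>The vector \<open>r + e K - e L\<close> for \<open>p = (K, L)\<close>. Subtraction is truncated, so this reading requires
  \<open>r L \<ge> 1\<close>.\<close>

definition move :: "(nat \<Rightarrow> nat) \<Rightarrow> nat \<times> nat \<Rightarrow> nat \<Rightarrow> nat" where
  "move r p = r(fst p := r (fst p) + 1, snd p := r (snd p) - 1)"

lemma observe_move:
  assumes "p \<in> offdiag n" "r (snd p) \<ge> 1"
  shows "observe n h (move r p) (prod.swap p) = observe n h r p"
proof -
  have eq: "2 * real (move r p i) + unit_transfer (prod.swap p) i
      = 2 * real (r i) + unit_transfer p i" for i
    using assms by (auto simp: move_def unit_transfer_def offdiag_def of_nat_diff)
  have "diff_signal h k l + h * (a - b) = h * ((2 * real k + a) - (2 * real l + b))" for k l a b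
    by (simp add: diff_signal_def algebra_simps)
  then show ?thesis
    unfolding observe_def by (simp only: eq)
qed

lemma error_prob_pair_noise:
  assumes n: "n \<ge> 2" and rhat: "rhat \<in> estimators n"
  shows "error_prob n (diff_signal h) (pair_noise n h) rhat r
     = ennreal (real (card {p \<in> offdiag n. rhat (observe n h r p) \<noteq> r}) / real (card (offdiag n)))"
proof -
  let ?q = "measure_pmf (pmf_of_set (offdiag n))"
  let ?Z = "\<lambda>p. \<lambda>(i, j)\<in>offdiag n. h * (unit_transfer p i - unit_transfer p j)"
  let ?X = "\<lambda>z. \<lambda>(i, j)\<in>offdiag n. diff_signal h (r i) (r j) + z (i, j)"
  let ?S = "{x \<in> space (obs_space n). rhat x \<noteq> r}"
  have "rhat -` (- {r}) \<inter> space (obs_space n) \<in> sets (obs_space n)"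
  proof -
    have "rhat -` (ranks n - {r}) \<inter> space (obs_space n) \<in> sets (obs_space n)"
      using rhat by (intro measurable_sets) (auto simp: estimators_def)
    moreover have "rhat -` (ranks n - {r}) \<inter> space (obs_space n)
        = rhat -` (- {r}) \<inter> space (obs_space n)"
      using rhat by (auto simp: estimators_def dest: measurable_space)
    ultimately show ?thesis by simp
  qed
  moreover have "?S = rhat -` (- {r}) \<inter> space (obs_space n)" by auto
  ultimately have S: "?S \<in> sets (obs_space n)" by simp
  have X: "?X \<in> measurable (obs_space n) (obs_space n)"
    unfolding obs_space_def
  proof (rule measurable_restrict)
    fix p assume "p \<in> offdiag n"
    then show "(\<lambda>z. case p of (i, j) \<Rightarrow> diff_signal h (r i) (r j) + z (i, j))
        \<in> borel_measurable (Pi\<^sub>M (offdiag n) (\<lambda>_. borel))"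
      by (cases p) (auto intro!: borel_measurable_add measurable_component_singleton)
  qed
  have comp: "?X \<circ> ?Z = observe n h r"
    by (auto simp: fun_eq_iff observe_def)
  have sp: "observe n h r p \<in> space (obs_space n)" for p
    by (auto simp: observe_def obs_space_def space_PiM)
  have "observation_law n (diff_signal h) (pair_noise n h) r = distr ?q (obs_space n) (observe n h r)"
    unfolding observation_law_def pair_noise_def
    by (subst distr_distr[OF X measurable_pmf_obs_space]) (simp only: comp)
  then have "error_prob n (diff_signal h) (pair_noise n h) rhat r
      = emeasure ?q {p. rhat (observe n h r p) \<noteq> r}"
    unfolding error_prob_def
    using S sp by (simp add: emeasure_distr observe_def[abs_def] measurable_pmf_obs_space vimage_def)
  also have "\<dots> = ennreal (measure ?q {p. rhat (observe n h r p) \<noteq> r})"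
    by (simp add: measure_pmf.emeasure_eq_measure)
  also have "measure ?q {p. rhat (observe n h r p) \<noteq> r}
      = real (card {p \<in> offdiag n. rhat (observe n h r p) \<noteq> r}) / real (card (offdiag n))"
    using offdiag_nonempty[OF n] by (simp add: measure_pmf_of_set Int_def)
  finally show ?thesis .
qed

text \<open>The map \<open>(r, p) \<mapsto> (move r p, prod.swap p)\<close> acts injectively on the pairs for which the move stays in
  the box, and it preserves the observation. It therefore sends every such pair on which the
  estimator is right to one on which it is wrong.\<close>

lemma exists_bad_rank:
  fixes rhat :: "(nat \<times> nat \<Rightarrow> real) \<Rightarrow> nat \<Rightarrow> nat"
  assumes n: "n \<ge> 2"
  shows "\<exists>r\<in>balanced n. real (card {p \<in> offdiag n. rhat (observe n h r p) \<noteq> r})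
           / real (card (offdiag n)) \<ge> 1 / 2 - 2 / (real n + 2)"
proof (rule ccontr)
  assume neg: "\<not> ?thesis"
  let ?A = "balanced n" and ?O = "offdiag n"
  let ?fail = "\<lambda>r. {p \<in> ?O. rhat (observe n h r p) \<noteq> r}"
  (* F: failures of the estimator; I: moves that stay in the box; B: moves that leave it,
     with the components in reversed order. *)
  define F where "F = (SIGMA r:?A. ?fail r)"
  define I where "I = {(r, p) \<in> ?A \<times> ?O. r (fst p) < n \<and> 1 < r (snd p)}"
  define B where "B = (SIGMA p:?O. top_face n (fst p) \<union> bottom_face n (snd p))"
  define \<phi> where "\<phi> = (\<lambda>(r, p). (move r p, prod.swap p))"
  have "finite F" "finite B" unfolding F_def B_def by (auto intro!: finite_SigmaI)
  moreover have "finite I" by (rule finite_subset[of _ "?A \<times> ?O"]) (auto simp: I_def)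
  ultimately have fin: "finite F" "finite I" "finite B" by auto
  have Opos: "card ?O > 0" using offdiag_nonempty[OF n] by (simp add: card_gt_0_iff)
  have Apos: "card ?A > 0" using balanced_nonempty by (simp add: card_gt_0_iff)

  have "card (I - F) \<le> card F"
  proof (rule card_inj_on_le[where f = \<phi>])
    show "inj_on \<phi> (I - F)"
    proof (rule inj_onI)
      fix x y assume xy: "x \<in> I - F" "y \<in> I - F" "\<phi> x = \<phi> y"
      obtain r p where x: "x = (r, p)" by (cases x)
      obtain s q where y: "y = (s, q)" by (cases y)
      have q: "q = p" and m: "move r p = move s p"
        using xy(3) unfolding x y \<phi>_def by (cases p; cases q; simp)+
      have p: "fst p \<noteq> snd p" "1 < r (snd p)" "1 < s (snd p)"
        using xy q unfolding x y I_def by (auto simp: offdiag_def)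
      have "r i = s i" for i
        using fun_cong[OF m, of i] p by (auto simp: move_def split: if_splits)
      then show "x = y" using x y q by auto
    qed
    show "\<phi> ` (I - F) \<subseteq> F"
    proof
      fix y assume "y \<in> \<phi> ` (I - F)"
      then obtain r p where rp: "(r, p) \<in> I" "(r, p) \<notin> F" and y: "y = (move r p, prod.swap p)"
        unfolding \<phi>_def by auto
      then have r: "r \<in> ?A" and p: "p \<in> ?O" and lt: "r (fst p) < n" "1 < r (snd p)"
        and ok: "rhat (observe n h r p) = r"
        unfolding I_def F_def by auto
      have "r (snd p) \<le> n" using balanced_range(2)[OF r, of "snd p"] p by (auto simp: offdiag_def)
      then have "move r p \<in> ?A"
        unfolding move_def using r p lt by (intro fun_upd2_balanced) auto
      moreover have "prod.swap p \<in> ?O" using p by (auto simp: offdiag_def)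
      moreover have "move r p (fst p) \<noteq> r (fst p)"
        using p by (auto simp: move_def offdiag_def)
      then have "rhat (observe n h (move r p) (prod.swap p)) \<noteq> move r p"
        using observe_move[OF p, of r h] lt ok by auto
      ultimately show "y \<in> F" unfolding F_def y by simp
    qed
  qed (use fin in auto)
  moreover have "card I \<le> card F + card (I - F)"
  proof -
    have "card I \<le> card (F \<union> (I - F))" using fin by (intro card_mono) auto
    also have "\<dots> \<le> card F + card (I - F)" by (rule card_Un_le)
    finally show ?thesis .
  qed
  ultimately have I_le: "card I \<le> 2 * card F" by linarith

  have "card (?A \<times> ?O) \<le> card (I \<union> prod.swap ` B)"
  proof (rule card_mono)
    show "?A \<times> ?O \<subseteq> I \<union> prod.swap ` B"
    proof
      fix x assume x: "x \<in> ?A \<times> ?O"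
      obtain r p where rp: "x = (r, p)" "r \<in> ?A" "p \<in> ?O" using x by auto
      then have "1 \<le> r (snd p)" "r (fst p) \<le> n"
        using balanced_range[OF rp(2)] by (auto simp: offdiag_def)
      then have "(r, p) \<in> I \<or> (p, r) \<in> B"
        using rp by (auto simp: I_def B_def top_face_def bottom_face_def)
      then show "x \<in> I \<union> prod.swap ` B" using rp by force
    qed
  qed (use fin in auto)
  also have "\<dots> \<le> card I + card (prod.swap ` B)" by (rule card_Un_le)
  also have "card (prod.swap ` B) = card B" by (rule card_image) simp
  finally have AO: "real (card ?A) * real (card ?O) \<le> 2 * real (card F) + real (card B)"
    using I_le by (simp add: card_cartesian_product flip: of_nat_mult)

  have face: "real (card (top_face n (fst p) \<union> bottom_face n (snd p)))
      \<le> 4 * real (card ?A) / (real n + 2)"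
    if "p \<in> ?O" for p
  proof -
    have p: "fst p \<in> {1..n}" "snd p \<in> {1..n}" using that by (auto simp: offdiag_def)
    have "card (top_face n (fst p) \<union> bottom_face n (snd p))
        \<le> card (top_face n (fst p)) + card (top_face n (snd p))"
      using card_Un_le[of "top_face n (fst p)" "bottom_face n (snd p)"]
        card_bottom_face_le[OF p(2)] by linarith
    then have "real (card (top_face n (fst p) \<union> bottom_face n (snd p)))
        \<le> real (card (top_face n (fst p))) + real (card (top_face n (snd p)))" by linarith
    also have "\<dots> \<le> 2 * real (card ?A) / (real n + 2) + 2 * real (card ?A) / (real n + 2)"
      using card_top_face_le[OF p(1) n] card_top_face_le[OF p(2) n]
      by (intro add_mono) (simp_all add: pos_le_divide_eq)
    finally show ?thesis by simp
  qed
  have "real (card B) = (\<Sum>p\<in>?O. real (card (top_face n (fst p) \<union> bottom_face n (snd p))))"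
    unfolding B_def by (subst card_SigmaI) auto
  also have "\<dots> \<le> (\<Sum>p\<in>?O. 4 * real (card ?A) / (real n + 2))"
    by (rule sum_mono) (rule face)
  finally have B_le: "real (card B) \<le> real (card ?O) * (4 * real (card ?A) / (real n + 2))" by simp

  have "real (card F) = (\<Sum>r\<in>?A. real (card (?fail r)))"
    unfolding F_def by (subst card_SigmaI) auto
  also have "\<dots> < (\<Sum>r\<in>?A. real (card ?O) * (1 / 2 - 2 / (real n + 2)))"
  proof (rule sum_strict_mono)
    fix r assume "r \<in> ?A"
    then have "real (card (?fail r)) / real (card ?O) < 1 / 2 - 2 / (real n + 2)"
      using neg by (auto simp: not_le)
    then show "real (card (?fail r)) < real (card ?O) * (1 / 2 - 2 / (real n + 2))"
      using Opos by (simp add: pos_divide_less_eq mult.commute)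
  qed (simp_all add: balanced_nonempty)
  finally have F_less:
    "real (card F) < real (card ?A) * (real (card ?O) * (1 / 2 - 2 / (real n + 2)))" by simp
  (* Twice the failures and the moves leaving the box together are too few to cover all pairs. *)
  have "x * (y * (1 / 2 - 2 / d)) * 2 + y * (4 * x / d) = x * y" for x y d :: real
    by (simp add: algebra_simps)
  from this[of "real (card ?A)" "real (card ?O)" "real n + 2"] AO B_le F_less
  show False by linarith
qed

lemma minimax_error_pair_noise_ge:
  assumes n: "n \<ge> 2" and c: "c \<ge> 0"
  shows "minimax_error n c (diff_signal h) (pair_noise n h) \<ge> ennreal (1 / 2 - 2 / (real n + 2))"
  unfolding minimax_error_def
proof (rule INF_greatest)
  fix rhat assume rhat: "rhat \<in> estimators n"
  obtain r where r: "r \<in> balanced n"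
    and bad: "real (card {p \<in> offdiag n. rhat (observe n h r p) \<noteq> r}) / real (card (offdiag n))
      \<ge> 1 / 2 - 2 / (real n + 2)"
    using exists_bad_rank[OF n] by blast
  have "r \<in> rank_space n c" using r balanced_subset_rank_space[OF c] by blast
  moreover have "ennreal (1 / 2 - 2 / (real n + 2))
      \<le> error_prob n (diff_signal h) (pair_noise n h) rhat r"
    unfolding error_prob_pair_noise[OF n rhat] by (rule ennreal_leI[OF bad])
  ultimately show "ennreal (1 / 2 - 2 / (real n + 2))
      \<le> (SUP r\<in>rank_space n c. error_prob n (diff_signal h) (pair_noise n h) rhat r)"
    by (intro SUP_upper2[of r]) auto
qed

section \<open>Asymptotic choice of the constants\<close>

lemma eventually_noise_thresholds:
  assumes "0 < \<delta>" "\<delta> < 1"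
  shows "\<forall>\<^sub>F n in sequentially.
    ln n / (ln 2 * (real n - 1)) \<le> real n powr (- (1 - \<delta> / 2))
    \<and> (8 / \<delta>) ^ 4 / (real n * (real n - 1)) \<le> real n powr (- (2 * (1 - \<delta>)))"
proof (rule eventually_conj)
  show "\<forall>\<^sub>F n in sequentially. ln n / (ln 2 * (real n - 1)) \<le> real n powr (- (1 - \<delta> / 2))"
    using assms by real_asymp
  show "\<forall>\<^sub>F n in sequentially.
      (8 / \<delta>) ^ 4 / (real n * (real n - 1)) \<le> real n powr (- (2 * (1 - \<delta>)))"
    using assms by real_asymp
qed

lemma eventually_smallo_sqrt:
  assumes c: "c \<in> o(\<lambda>n. sqrt (real n))" and \<gamma>: "\<gamma> > 1"
  shows "\<forall>\<^sub>F n in sequentially. \<gamma> * (real n - 4 * (c n)\<^sup>2) \<ge> real n"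
proof -
  (* The value for which gamma * (1 - 4 * epsilon^2) = 1. *)
  define \<epsilon> where "\<epsilon> = sqrt (1 - 1 / \<gamma>) / 2"
  have \<epsilon>: "\<epsilon> > 0" "\<epsilon>\<^sup>2 = (1 - 1 / \<gamma>) / 4"
    using \<gamma> by (auto simp: \<epsilon>_def power_divide)
  have "\<forall>\<^sub>F n in sequentially. norm (c n) \<le> \<epsilon> * norm (sqrt (real n))"
    using landau_o.smallD[OF c \<epsilon>(1)] .
  then show ?thesis
  proof eventually_elim
    case (elim n)
    then have "(norm (c n))\<^sup>2 \<le> (\<epsilon> * norm (sqrt (real n)))\<^sup>2" by (rule power_mono) simp
    then have "(c n)\<^sup>2 \<le> (1 - 1 / \<gamma>) / 4 * real n" by (simp add: power_mult_distrib \<epsilon>)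
    then have "\<gamma> * (real n - 4 * ((1 - 1 / \<gamma>) / 4 * real n)) \<le> \<gamma> * (real n - 4 * (c n)\<^sup>2)"
      using \<gamma> by (intro mult_left_mono) auto
    also have "\<gamma> * (real n - 4 * ((1 - 1 / \<gamma>) / 4 * real n)) = real n"
      using \<gamma> by (simp add: field_simps)
    finally show ?case .
  qed
qed

theorem theorem2p5:
  fixes M :: real and \<beta> \<sigma> c :: "nat \<Rightarrow> real"
  assumes M: "M > 1"
    and c_ge_1: "\<And>n. n \<ge> 1 \<Longrightarrow> c n \<ge> 1"
    and c_small: "c \<in> o(\<lambda>n. sqrt (real n))"
    and sigma_pos: "\<And>n. n \<ge> 1 \<Longrightarrow> \<sigma> n > 0"
    and snr: "limsup (\<lambda>n. ereal (real n * (\<beta> n)\<^sup>2 / (4 * (\<sigma> n)\<^sup>2 * ln (real n)))) < 1"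
  shows "\<exists>(\<mu> :: nat \<Rightarrow> nat \<Rightarrow> nat \<Rightarrow> real) (\<nu> :: nat \<Rightarrow> (nat \<times> nat \<Rightarrow> real) measure).
     (\<forall>\<^sub>F n in sequentially.
        noise_distribution n (\<nu> n) \<and>
        noise_condition n (\<sigma> n) (\<nu> n) \<and>
        signal_condition n (c n) (\<beta> n) (\<mu> n) \<and>
        upper_signal_condition n (c n) M (\<beta> n) (\<mu> n)) \<and>
     liminf (\<lambda>n. minimax_error n (c n) (\<mu> n) (\<nu> n)) \<ge> 1 / 2"
proof -
  obtain \<rho>' where \<rho>': "limsup (\<lambda>n. ereal (real n * (\<beta> n)\<^sup>2 / (4 * (\<sigma> n)\<^sup>2 * ln (real n)))) < ereal \<rho>'"
    "ereal \<rho>' < 1"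
    using ereal_dense2[OF snr] by blast
  (* The maximum makes rho positive, so that a gamma above 1 with gamma * rho < 1 can be read off. *)
  define \<rho> where "\<rho> = max \<rho>' (1 / 2)"
  have \<rho>: "\<rho> > 0" "\<rho> < 1" using \<rho>'(2) by (auto simp: \<rho>_def one_ereal_def)
  define \<delta> where "\<delta> = 1 - sqrt \<rho>"
  define \<gamma> where "\<gamma> = min M (1 / sqrt \<rho>)"
  have \<delta>: "0 < \<delta>" "\<delta> < 1" using \<rho> by (auto simp: \<delta>_def)
  have \<gamma>: "\<gamma> > 1" "\<gamma> \<le> M" using \<rho> M by (auto simp: \<gamma>_def)
  have "\<gamma> * \<rho> \<le> 1 / sqrt \<rho> * \<rho>" using \<rho> by (intro mult_right_mono) (auto simp: \<gamma>_def)
  also have "\<dots> = 1 - \<delta>" using \<rho> by (simp add: \<delta>_def real_div_sqrt)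
  finally have \<gamma>\<rho>: "\<gamma> * \<rho> \<le> 1 - \<delta>" .
  define h where "h n = sqrt \<gamma> * \<bar>\<beta> n\<bar> / 2" for n
  have h: "h n \<ge> 0" "(2 * h n)\<^sup>2 = \<gamma> * (\<beta> n)\<^sup>2" for n
    using \<gamma> by (auto simp: h_def power_mult_distrib)
  define \<mu> where "\<mu> n = diff_signal (h n)" for n
  define \<nu> where "\<nu> n = pair_noise n (h n)" for n
  have "\<forall>\<^sub>F n in sequentially.
      ereal (real n * (\<beta> n)\<^sup>2 / (4 * (\<sigma> n)\<^sup>2 * ln (real n))) < ereal \<rho>'"
    by (rule Limsup_lessD[OF \<rho>'(1)])
  then have "\<forall>\<^sub>F n in sequentially.
      noise_distribution n (\<nu> n) \<and>
      noise_condition n (\<sigma> n) (\<nu> n) \<and>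
      signal_condition n (c n) (\<beta> n) (\<mu> n) \<and>
      upper_signal_condition n (c n) M (\<beta> n) (\<mu> n)"
    using eventually_noise_thresholds[OF \<delta>] eventually_smallo_sqrt[OF c_small \<gamma>(1)]
      eventually_ge_at_top[of 2]
  proof eventually_elim
    case (elim n)
    have \<sigma>: "\<sigma> n > 0" using sigma_pos[of n] elim(4) by simp
    have lnpos: "ln (real n) > 0" using elim(4) by simp
    have "real n * (\<beta> n)\<^sup>2 / (4 * (\<sigma> n)\<^sup>2 * ln (real n)) \<le> \<rho>"
      using elim(1) by (simp add: \<rho>_def)
    then have "real n * (\<beta> n)\<^sup>2 / (4 * (\<sigma> n)\<^sup>2) / ln (real n) \<le> \<rho>"
      by (simp only: divide_divide_eq_left)
    then have le: "real n * (\<beta> n)\<^sup>2 / (4 * (\<sigma> n)\<^sup>2) \<le> \<rho> * ln (real n)"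
      using lnpos by (simp only: pos_divide_le_eq)
    have h_sq: "(h n)\<^sup>2 = \<gamma> * (\<beta> n)\<^sup>2 / 4" using h(2)[of n] by (simp add: power_mult_distrib)
    have "real n * (h n)\<^sup>2 / (\<sigma> n)\<^sup>2 = \<gamma> * (real n * (\<beta> n)\<^sup>2 / (4 * (\<sigma> n)\<^sup>2))"
      unfolding h_sq by simp
    also have "\<dots> \<le> \<gamma> * (\<rho> * ln (real n))" using \<gamma> by (intro mult_left_mono[OF le]) simp
    also have "\<dots> = (\<gamma> * \<rho>) * ln (real n)" by simp
    also have "\<dots> \<le> (1 - \<delta>) * ln (real n)"
      using lnpos by (intro mult_right_mono[OF \<gamma>\<rho>]) simp
    finally have "noise_condition n (\<sigma> n) (\<nu> n)"
      unfolding \<nu>_def using elim \<delta> h \<sigma> by (intro noise_condition_pair_noise) auto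
    moreover have "noise_distribution n (\<nu> n)"
      unfolding \<nu>_def by (rule noise_distribution_pair_noise)
    moreover have "signal_condition n (c n) (\<beta> n) (\<mu> n)"
      unfolding \<mu>_def by (rule signal_condition_diff_signal[OF h(2) elim(3)])
    moreover have "upper_signal_condition n (c n) M (\<beta> n) (\<mu> n)"
      unfolding \<mu>_def by (rule upper_signal_condition_diff_signal[OF h(2) \<gamma>(2)])
    ultimately show ?case by simp
  qed
  moreover have "1 / 2 \<le> liminf (\<lambda>n. minimax_error n (c n) (\<mu> n) (\<nu> n))"
  proof -
    have "(\<lambda>n. 1 / 2 - 2 / (real n + 2)) \<longlonglongrightarrow> 1 / 2" by real_asymp
    then have "(\<lambda>n. ennreal (1 / 2 - 2 / (real n + 2))) \<longlonglongrightarrow> ennreal (1 / 2)"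
      by (rule tendsto_ennrealI)
    then have lim: "liminf (\<lambda>n. ennreal (1 / 2 - 2 / (real n + 2))) = ennreal (1 / 2)"
      by (intro lim_imp_Liminf) auto
    have "\<forall>\<^sub>F n in sequentially.
        ennreal (1 / 2 - 2 / (real n + 2)) \<le> minimax_error n (c n) (\<mu> n) (\<nu> n)"
      using eventually_ge_at_top[of 2]
    proof eventually_elim
      case (elim n)
      then show ?case
        unfolding \<mu>_def \<nu>_def using c_ge_1[of n] by (intro minimax_error_pair_noise_ge) auto
    qed
    then have "ennreal (1 / 2) \<le> liminf (\<lambda>n. minimax_error n (c n) (\<mu> n) (\<nu> n))"
      unfolding lim[symmetric] by (rule Liminf_mono)
    then show ?thesis
      using divide_ennreal[of 1 2] by simp
  qed
  ultimately show ?thesis by blast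
qed

end
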